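(* Let $G$ be a simple graph with $n \geq 4$ vertices and $m$ edges, with degree sequence $\Delta = d_1 \geq d_2 \geq \cdots \geq d_n = \delta > 0$. Then for any $\alpha \in \mathbb{R}$ and any pairwise distinct indices $j, k, \ell \in \{1, \dots, n\}$, \[ Z_{2\alpha}(G) \geq d_\ell^{2\alpha} + \frac{(Z_\alpha(G) - d_\ell^\alpha)^2}{n-1} + \frac{1}{2}\left(d_j^\alpha - d_k^\alpha\right)^2 + \frac{2(n-1)}{n-3}\left(\frac{Z_\alpha(G) - d_\ell^\alpha}{n-1} - \frac{d_j^\alpha + d_k^\alpha}{2}\right)^2. \]
   Context: For a graph $G$ with vertex degrees $d_1,\dots,d_n$ and $\beta \in \mathbb{R}$, the first general Zagreb index is $Z_\beta(G) = \sum_{i=1}^n d_i^\beta$. *)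

theory Defs
  imports Complex_Main "Graph_Theory.Digraph"
begin

text \<open>
  The locale \<^locale>\<open>graph\<close> represents a finite simple graph as a symmetric digraph without loops
  and without parallel arcs, so every undirected edge is a pair of opposite arcs. The degree of a
  vertex is therefore its \<^const>\<open>out_degree\<close>: see \<open>out_degree_eq_card_neighbours\<close> below. The
  number of edges is half the number of arcs.
\<close>

definition edges :: "('a, 'b) pre_digraph \<Rightarrow> 'a set set" where
  "edges G = {{u, v} | u v. u \<rightarrow>\<^bsub>G\<^esub> v}"

lemma (in graph) out_degree_eq_card_neighbours:
  "out_degree G v = card {w. v \<rightarrow>\<^bsub>G\<^esub> w}"
proof -
  have "{w. v \<rightarrow>\<^bsub>G\<^esub> w} = head G ` out_arcs G v"
    by (auto simp: arcs_ends_conv out_arcs_def)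
  moreover have "inj_on (head G) (out_arcs G v)"
    by (auto simp: inj_on_def arc_to_ends_def intro!: no_multi_arcs)
  ultimately show ?thesis
    by (simp add: out_degree_def card_image)
qed

text \<open>Only the values of \<open>d\<close> on \<open>{1..card (verts G)}\<close> matter.\<close>

definition degree_sequence :: "('a, 'b) pre_digraph \<Rightarrow> (nat \<Rightarrow> nat) \<Rightarrow> bool" where
  "degree_sequence G d \<longleftrightarrow>
     (\<exists>v. bij_betw v {1..card (verts G)} (verts G) \<and>
          (\<forall>i\<in>{1..card (verts G)}. d i = out_degree G (v i))) \<and>
     monotone_on {1..card (verts G)} (\<le>) (\<ge>) d"

text \<open>
  Since \<open>0 powr \<beta> = 0\<close> for all \<open>\<beta>\<close>, this is the intended sum only if \<open>G\<close> has no isolated vertices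
  or \<open>\<beta> > 0\<close>.
\<close>

definition general_zagreb :: "real \<Rightarrow> ('a, 'b) pre_digraph \<Rightarrow> real" where
  "general_zagreb \<beta> G = (\<Sum>v\<in>verts G. real (out_degree G v) powr \<beta>)"

end

theory Submission
  imports Defs "HOL-Analysis.Convex"
begin

text \<open>
  Fixing the two terms \<open>x j\<close> and \<open>x k\<close>, the remaining terms contribute at least their squared sum
  divided by their number (Cauchy-Schwarz). The right-hand side below is exactly this bound,
  rearranged around the mean of all terms.
\<close>

lemma sum_squares_ge_two_terms:
  fixes x :: "'i \<Rightarrow> real"
  assumes "finite A" "card A \<ge> 3" "j \<in> A" "k \<in> A" "j \<noteq> k"
  defines "N \<equiv> real (card A)"
  shows "(\<Sum>i\<in>A. (x i)\<^sup>2) \<ge> (sum x A)\<^sup>2 / N + 1 / 2 * (x j - x k)\<^sup>2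
           + 2 * N / (N - 2) * (sum x A / N - (x j + x k) / 2)\<^sup>2"
proof -
  define B where "B = A - {j, k}"
  have A: "A = insert j (insert k B)" "j \<notin> insert k B" "k \<notin> B" and "finite B"
    using assms by (auto simp: B_def)
  have split: "sum f A = f j + (f k + sum f B)" for f :: "'i \<Rightarrow> real"
    unfolding A(1) using A(2,3) \<open>finite B\<close> by simp
  have card: "N = real (card B) + 2"
    unfolding N_def A(1) using A(2,3) \<open>finite B\<close> by simp
  \<comment> \<open>At least one term lies outside the pair, so dividing by \<open>card B\<close> is
    meaningful; this is where \<open>card A \<ge> 3\<close> enters.\<close>
  have pos: "real (card B) > 0"
    using card assms(2) unfolding N_def by linarith
  have "(sum x B)\<^sup>2 \<le> (\<Sum>i\<in>B. (x i)\<^sup>2) * card B"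
    using sum_squared_le_sum_of_squares[of x B] by simp
  then have cs: "(sum x B)\<^sup>2 / card B \<le> (\<Sum>i\<in>B. (x i)\<^sup>2)"
    using pos by (simp add: pos_divide_le_eq)
  \<comment> \<open>Here \<open>c\<close> and \<open>T\<close> stand for the size and the sum of
    \<open>B\<close>. Put \<open>s = a + b\<close>. Then
    \<open>a^2 + b^2 = (a - b)^2/2 + s^2/2\<close>, and \<open>s^2/2 + T^2/c\<close> is
    \<open>(s + T)^2/(c + 2)\<close> plus \<open>2 * c/(c + 2)\<close> times the square of
    \<open>T/c - s/2\<close>. The latter difference is \<open>(c + 2)/c\<close> times the overall
    mean minus the pair mean \<open>s/2\<close>.\<close>
  have "(a + b + T)\<^sup>2 / (c + 2) + 1 / 2 * (a - b)\<^sup>2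
          + 2 * (c + 2) / c * ((a + b + T) / (c + 2) - (a + b) / 2)\<^sup>2
        = a\<^sup>2 + b\<^sup>2 + T\<^sup>2 / c" if "c > 0" for a b c T :: real
  proof -
    have "c \<noteq> 0" "c + 2 \<noteq> 0"
      using that by auto
    then show ?thesis
      by (simp add: divide_simps) algebra
  qed
  from this[OF pos, of "x j" "x k" "sum x B"] show ?thesis
    using cs unfolding split card by (simp add: add.assoc)
qed

text \<open>The index is defined over vertices, the inequality is about positions in the sequence;
  the enumeration of the vertices behind \<open>d\<close> carries one sum to the other.\<close>

lemma general_zagreb_degree_sequence:
  assumes "degree_sequence G d"
  shows "general_zagreb \<beta> G = (\<Sum>i = 1..card (verts G). real (d i) powr \<beta>)"
proof -
  obtain v where v: "bij_betw v {1..card (verts G)} (verts G)"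
      "\<forall>i\<in>{1..card (verts G)}. d i = out_degree G (v i)"
    using assms unfolding degree_sequence_def by blast
  show ?thesis
    unfolding general_zagreb_def sum.reindex_bij_betw[OF v(1), symmetric]
    using v(2) by (intro sum.cong) auto
qed

theorem theorem2:
  fixes G :: "('a, 'b) pre_digraph"
    and n m \<Delta> \<delta> j k l :: nat
    and d :: "nat \<Rightarrow> nat"
    and \<alpha> :: real
  assumes "graph G"
    and "n = card (verts G)"
    and "n \<ge> 4"
    and "m = card (edges G)"
    and "degree_sequence G d"
    and "\<Delta> = d 1"
    and "\<delta> = d n"
    and "\<delta> > 0"
    and "j \<in> {1..n}" and "k \<in> {1..n}" and "l \<in> {1..n}"
    and "j \<noteq> k" and "j \<noteq> l" and "k \<noteq> l"
  shows "general_zagreb (2 * \<alpha>) G \<ge>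
           real (d l) powr (2 * \<alpha>)
           + (general_zagreb \<alpha> G - real (d l) powr \<alpha>)\<^sup>2 / (real n - 1)
           + 1 / 2 * (real (d j) powr \<alpha> - real (d k) powr \<alpha>)\<^sup>2
           + 2 * (real n - 1) / (real n - 3)
             * ((general_zagreb \<alpha> G - real (d l) powr \<alpha>) / (real n - 1)
                - (real (d j) powr \<alpha> + real (d k) powr \<alpha>) / 2)\<^sup>2"
proof -
  define x where "x i = real (d i) powr \<alpha>" for i
  \<comment> \<open>The term of \<open>l\<close> splits off from both sums, and the two-term bound
    is applied to the other \<open>n - 1 \<ge> 3\<close> indices, among which are \<open>j\<close>
    and \<open>k\<close>.\<close>
  define A where "A = {1..n} - {l}"
  \<comment> \<open>This covers every \<open>i\<close>, even outside \<open>{1..n}\<close> where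
    \<open>d i\<close> may be 0: the convention \<open>0 powr b = 0\<close> keeps
    \<open>powr_add\<close> valid there.\<close>
  have sq: "real (d i) powr (2 * \<alpha>) = (x i)\<^sup>2" for i
    unfolding x_def by (simp add: power2_eq_square flip: powr_add)
  have card: "card A = n - 1"
    using assms(11) by (simp add: A_def)
  have split: "(\<Sum>i = 1..n. f i) = f l + sum f A" for f :: "nat \<Rightarrow> real"
    unfolding A_def using assms(11) by (simp add: sum.remove)
  have Z: "general_zagreb \<alpha> G = x l + sum x A"
    using general_zagreb_degree_sequence[OF assms(5)] split[of x] by (simp add: assms(2) x_def)
  have Z2: "general_zagreb (2 * \<alpha>) G = (x l)\<^sup>2 + (\<Sum>i\<in>A. (x i)\<^sup>2)"
    using general_zagreb_degree_sequence[OF assms(5)] split[of "\<lambda>i. (x i)\<^sup>2"]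
    by (simp add: assms(2) sq)
  \<comment> \<open>The second equation turns the \<open>N - 2\<close> of the two-term bound into
    the denominator \<open>real n - 3\<close>.\<close>
  have N: "real (card A) = real n - 1" "real n - 1 - 2 = real n - 3"
    using assms(3) card by auto
  have "(sum x A)\<^sup>2 / (real n - 1) + 1 / 2 * (x j - x k)\<^sup>2
          + 2 * (real n - 1) / (real n - 3) * (sum x A / (real n - 1) - (x j + x k) / 2)\<^sup>2
        \<le> (\<Sum>i\<in>A. (x i)\<^sup>2)"
    using sum_squares_ge_two_terms[of A j k x] assms card unfolding N by (simp add: A_def)
  then show ?thesis
    unfolding Z Z2 sq x_def[symmetric] by simp
qed

end
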